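(* Let $p\ge 3$ be a prime, $m\ge 1$ an integer and $\alpha\in[0,1)$. Put $$x=(1+\alpha)p^m-2p^{m-1}-1,\qquad y=\sqrt{\left(1-p^m+\alpha p^m\right)^2+4(1-\alpha)p^{m-1}}.$$ Then the $A_\alpha$-energy of the unitary addition Cayley graph $G_{p^m}$ is $$\begin{aligned}\varepsilon_\alpha(G_{p^m})={}&\frac{3p^{m}-5p^{m-1}-p-1}{2}+\frac{\alpha}{2p}\left(-3p^{m+1}+9p^m-4p^{m-1}+p^2-2p+1\right)\\&+\frac{p-1}{2p}\left|(p^m-p)(1-\alpha)-\alpha\right|+\left|\frac{x-y}{2}-\frac{\alpha(p^m-1)(p-1)}{p}\right|\\&+\left|\frac{x+y}{2}-\frac{\alpha(p^m-1)(p-1)}{p}\right|.\end{aligned}$$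
   Context: For an integer $n>1$, the unitary addition Cayley graph $G_n$ is the simple undirected graph with vertex set $\mathbb{Z}_n=\{0,1,\dots,n-1\}$ in which two distinct vertices $a,b$ are adjacent if and only if $a+b$ is a unit of the ring $\mathbb{Z}_n$, i.e. $\gcd(a+b,n)=1$ (no loops). For a simple graph $G$ with adjacency matrix $A(G)$ and diagonal matrix of vertex degrees $D(G)$, and $\alpha\in[0,1]$, the $A_\alpha$-matrix is $A_\alpha(G)=\alpha D(G)+(1-\alpha)A(G)$. For a graph $G$ with $N$ vertices and $M$ edges and $\alpha\in[0,1)$, the $A_\alpha$-energy is $$\varepsilon_\alpha(G)=\sum_{i=1}^{N}\left|\lambda_i(A_\alpha(G))-\frac{2\alpha M}{N}\right|,$$ where $\lambda_1(A_\alpha(G)),\dots,\lambda_N(A_\alpha(G))$ are the eigenvalues of $A_\alpha(G)$ counted with multiplicity. *)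

theory Defs
  imports
    Complex_Main
    "HOL-Computational_Algebra.Primes"
    "HOL-Computational_Algebra.Polynomial"
    "Jordan_Normal_Form.Char_Poly"
    "Graph_Theory.Pair_Digraph"
begin

text \<open>
  As in Graph\_Theory, an undirected simple graph is a finite symmetric digraph without loops and
  without parallel arcs (locale \<^locale>\<open>pair_graph\<close>): an undirected edge between \<open>u\<close> and \<open>v\<close> is
  the pair of arcs \<open>(u,v)\<close>, \<open>(v,u)\<close>. Degrees are therefore out-degrees, and undirected edges are
  counted as unordered pairs of end points.
\<close>

definition uedges :: "'a pair_pre_digraph \<Rightarrow> 'a set set" where
  "uedges G = {{u, v} | u v. (u, v) \<in> parcs G}"

text \<open>Rows and columns of the matrices of a graph follow the increasing order of its vertices.\<close>

definition vertex_at :: "'a::linorder pair_pre_digraph \<Rightarrow> nat \<Rightarrow> 'a" where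
  "vertex_at G i = sorted_list_of_set (pverts G) ! i"

definition adjacency_matrix :: "'a::linorder pair_pre_digraph \<Rightarrow> real mat" where
  "adjacency_matrix G = mat (card (pverts G)) (card (pverts G))
     (\<lambda>(i, j). if (vertex_at G i, vertex_at G j) \<in> parcs G then 1 else 0)"

definition degree_matrix :: "'a::linorder pair_pre_digraph \<Rightarrow> real mat" where
  "degree_matrix G =
     mat_diag (card (pverts G)) (\<lambda>i. real (out_degree (with_proj G) (vertex_at G i)))"

definition A_alpha_matrix :: "real \<Rightarrow> 'a::linorder pair_pre_digraph \<Rightarrow> real mat" where
  "A_alpha_matrix \<alpha> G = \<alpha> \<cdot>\<^sub>m degree_matrix G + (1 - \<alpha>) \<cdot>\<^sub>m adjacency_matrix G"

text \<open>
  The eigenvalues of a real square matrix with their algebraic multiplicities, taken in the complex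
  numbers so that an \<open>N \<times> N\<close> matrix always has exactly \<open>N\<close> of them. For the symmetric matrices
  considered here they are all real, and algebraic and geometric multiplicities agree.
\<close>

definition eigenvalues_mset :: "real mat \<Rightarrow> complex multiset" where
  "eigenvalues_mset A = proots (char_poly (map_mat complex_of_real A))"

definition A_alpha_energy :: "real \<Rightarrow> 'a::linorder pair_pre_digraph \<Rightarrow> real" where
  "A_alpha_energy \<alpha> G =
     (\<Sum>l\<in>#eigenvalues_mset (A_alpha_matrix \<alpha> G).
        cmod (l - complex_of_real
          (2 * \<alpha> * real (card (uedges G)) / real (card (pverts G)))))"

definition unitary_addition_Cayley_graph :: "nat \<Rightarrow> nat pair_pre_digraph" where
  "unitary_addition_Cayley_graph n =
     \<lparr> pverts = {0..<n},
       parcs = {(a, b). a < n \<and> b < n \<and> a \<noteq> b \<and> coprime (a + b) n} \<rparr>"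

lemma pair_graph_unitary_addition_Cayley_graph:
  "pair_graph (unitary_addition_Cayley_graph n)"
proof -
  have "finite {(a, b). a < n \<and> b < n \<and> a \<noteq> b \<and> coprime (a + b) n}"
    by (rule finite_subset[of _ "{..<n} \<times> {..<n}"]) auto
  thus ?thesis
    by unfold_locales
      (auto simp: unitary_addition_Cayley_graph_def symmetric_def sym_def arcs_ends_def
        arc_to_ends_def with_proj_def add.commute)
qed

end

theory Submission
  imports Defs
begin

text \<open>
  Write \<open>n = p ^ m = p * q\<close>. An element of \<open>\<int>\<^sub>n\<close> is a unit iff its residue modulo \<open>p\<close> is nonzero, so
  adjacency of \<open>a\<close> and \<open>b\<close> depends only on their residues, except that loops are removed; a loop
  would sit at \<open>a\<close> iff \<open>p\<close> does not divide \<open>2 * a\<close>, that is, iff \<open>p\<close> does not divide \<open>a\<close>. Removing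
  it lowers the degree of \<open>a\<close> by one, and with \<open>\<mu> = \<alpha> * (n - q)\<close>, \<open>\<beta> = 1 - \<alpha>\<close> and Iverson
  brackets the entry of the \<open>A\<^sub>\<alpha>\<close>-matrix at \<open>(i, j)\<close> becomes
  \<open>[i = j] * (\<mu> - [\<not> p dvd j]) + \<beta> * [\<not> p dvd i + j]\<close>.

  The eigenvalues follow from three reductions. Differences of two unit vectors in the same residue
  class are eigenvectors. Modulo these the matrix acts on the \<open>p\<close> residues, where it commutes with
  \<open>r \<mapsto> - r\<close>; the differences of opposite residues are eigenvectors for \<open>\<mu> - 1 + \<beta> q\<close>. Modulo
  these again, the differences of two nonzero residues are eigenvectors for \<open>\<mu> - 1 - \<beta> q\<close>. What
  remains is a \<open>2 \<times> 2\<close> matrix on the classes of \<open>0\<close> and \<open>1\<close>, whose eigenvalues are \<open>(x \<plusminus> y) / 2\<close>.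

  All reductions are done at once by a single change of basis. Each index \<open>j \<ge> 2\<close> gets a parent:
  its residue if \<open>j \<ge> p\<close>, its opposite if \<open>j\<close> lies in the upper half of the residues, and \<open>1\<close>
  otherwise. The basis consists of \<open>e\<^sub>0\<close>, \<open>e\<^sub>1\<close> and the differences of \<open>e\<^sub>j\<close> and the unit vector of
  the parent of \<open>j\<close>. Coordinates in this basis are sums over sets of descendants
  (\<open>similar_mat_differences_to_parents\<close>), and column sums of the matrix over such sets are easy to
  compute (\<open>sum_below\<close>). The transformed matrix turns out to be lower triangular outside the leading
  \<open>2 \<times> 2\<close> block, so that its characteristic polynomial can be read off
  (\<open>char_poly_residue_mat\<close>). The mean of the eigenvalues is \<open>\<alpha>\<close> times the mean degree,
  which comes from the handshake lemma, and \<open>sum_diagonal_entry\<close> adds up the deviations from it.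
\<close>

section \<open>Characteristic polynomials and bases of differences\<close>

text \<open>
  Keeping a \<open>2 \<times> 2\<close> block instead of a triangular matrix leaves room for a quadratic factor, so that
  the change of basis below needs no square roots.
\<close>

lemma char_poly_block_lower_triangular_2:
  fixes B :: "'a::idom mat"
  assumes B: "B \<in> carrier_mat n n" and n: "2 \<le> n"
    and zero: "\<And>i j. i < j \<Longrightarrow> 2 \<le> j \<Longrightarrow> j < n \<Longrightarrow> B $$ (i, j) = 0"
  shows "char_poly B =
    [:B $$ (0, 0) * B $$ (1, 1) - B $$ (0, 1) * B $$ (1, 0), - (B $$ (0, 0) + B $$ (1, 1)), 1:]
    * (\<Prod>k = 2..<n. [:- B $$ (k, k), 1:])"
proof -
  define C where "C = char_poly_matrix B"
  define m where "m = n - 2"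
  define C1 C3 C4 where "C1 = mat 2 2 (\<lambda>(i, j). C $$ (i, j))"
    and "C3 = mat m 2 (\<lambda>(i, j). C $$ (i + 2, j))"
    and "C4 = mat m m (\<lambda>(i, j). C $$ (i + 2, j + 2))"
  have nm: "n = 2 + m" using n by (simp add: m_def)
  have C: "C \<in> carrier_mat n n" using B by (simp add: C_def)
  have C_entry: "C $$ (i, j) = (if i = j then [:- B $$ (i, j), 1:] else [:- B $$ (i, j):])"
    if "i < n" "j < n" for i j
    using that B by (auto simp: C_def char_poly_matrix_def)
  have shift: "Suc (Suc (k - 2)) = k" if "\<not> k < 2" for k :: nat
    using that by simp
  have "C = four_block_mat C1 (0\<^sub>m 2 m) C3 C4"
  proof (rule eq_matI)
    fix i j assume "i < dim_row (four_block_mat C1 (0\<^sub>m 2 m) C3 C4)"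
      "j < dim_col (four_block_mat C1 (0\<^sub>m 2 m) C3 C4)"
    then have ij: "i < n" "j < n" by (auto simp: nm C1_def C4_def)
    show "C $$ (i, j) = four_block_mat C1 (0\<^sub>m 2 m) C3 C4 $$ (i, j)"
      using ij zero[of i j] C_entry[of i j] shift[of i] shift[of j]
      by (cases "i < 2"; cases "j < 2") (auto simp: C1_def C3_def C4_def nm)
  qed (use C in \<open>auto simp: C1_def C4_def nm\<close>)
  also have "det \<dots> = det C1 * det C4"
    unfolding C1_def C3_def C4_def
    by (rule det_four_block_mat_upper_right_zero) (rule mat_carrier refl)+
  finally have "det C = det C1 * det C4" .
  moreover have "det C4 = (\<Prod>k = 2..<n. [:- B $$ (k, k), 1:])"
  proof -
    have "det C4 = prod_list (diag_mat C4)"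
    proof (rule det_lower_triangular[of m])
      fix i j assume "i < j" "j < m"
      then show "C4 $$ (i, j) = 0"
        using zero[of "i + 2" "j + 2"] C_entry[of "i + 2" "j + 2"] by (simp add: C4_def nm)
    qed (simp add: C4_def)
    also have "\<dots> = (\<Prod>k = 0..<m. C4 $$ (k, k))"
      by (simp add: prod_list_diag_prod C4_def)
    also have "\<dots> = (\<Prod>k = 0..<m. [:- B $$ (k + 2, k + 2), 1:])"
      by (rule prod.cong) (auto simp: C4_def C_entry nm)
    also have "\<dots> = (\<Prod>k = 0 + 2..<m + 2. [:- B $$ (k, k), 1:])"
      by (rule prod.shift_bounds_nat_ivl[symmetric])
    finally show ?thesis by (simp only: nm add_0 add.commute[of m 2])
  qed
  moreover have "det C1 =
    [:B $$ (0, 0) * B $$ (1, 1) - B $$ (0, 1) * B $$ (1, 0), - (B $$ (0, 0) + B $$ (1, 1)), 1:]"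
  proof -
    have minor: "cofactor C1 0 j = (if j = 0 then C $$ (1, 1) else - C $$ (1, 0))" if "j < 2" for j
      using that
      by (auto simp: cofactor_def C1_def less_2_cases_iff det_single
        mat_delete_def)
    have "det C1 = (\<Sum>j<2. C1 $$ (0, j) * cofactor C1 0 j)"
      by (rule laplace_expansion_row[of _ 2]) (simp_all add: C1_def)
    also have "\<dots> = C $$ (0, 0) * C $$ (1, 1) - C $$ (0, 1) * C $$ (1, 0)"
      by (simp add: lessThan_nat_numeral lessThan_Suc minor) (simp add: C1_def)
    finally show ?thesis using n by (simp add: C_entry algebra_simps)
  qed
  ultimately show ?thesis by (simp add: char_poly_def C_def)
qed

text \<open>
  The indices form a forest: the roots are the indices below \<open>r\<close>, and \<open>S k\<close> is the set of
  descendants of \<open>k\<close>, including \<open>k\<close>. Take the basis of the \<open>e\<^sub>j\<close> for roots \<open>j\<close> and of the differences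
  of \<open>e\<^sub>j\<close> and \<open>e\<^sub>i\<close>, \<open>i\<close> the parent of \<open>j\<close>, for the other \<open>j\<close>. Summing these differences along
  the path from a root to \<open>i\<close> telescopes to \<open>e\<^sub>i\<close>, so the \<open>k\<close>-th coordinate of \<open>e\<^sub>i\<close> is \<open>1\<close> if \<open>k\<close> lies
  on that path, i.e. \<open>i \<in> S k\<close>, and \<open>0\<close> otherwise. The \<open>k\<close>-th coordinate of a vector is therefore
  the sum of its entries over \<open>S k\<close>.
\<close>

lemma similar_mat_differences_to_parents:
  fixes A :: "'a::field mat" and parent :: "nat \<Rightarrow> nat"
  assumes A: "A \<in> carrier_mat n n"
    and parent: "\<And>j. r \<le> j \<Longrightarrow> j < n \<Longrightarrow> parent j < n"
    and sub: "\<And>k. k < n \<Longrightarrow> S k \<subseteq> {..<n}"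
    and self: "\<And>j. j < n \<Longrightarrow> j \<in> S j"
    and parent_notin: "\<And>j. r \<le> j \<Longrightarrow> j < n \<Longrightarrow> parent j \<notin> S j"
    and step: "\<And>j k. j < n \<Longrightarrow> k < n \<Longrightarrow> k \<noteq> j \<Longrightarrow> j \<in> S k \<longleftrightarrow> r \<le> j \<and> parent j \<in> S k"
  shows "similar_mat A (mat n n (\<lambda>(k, j).
    (\<Sum>i\<in>S k. A $$ (i, j)) - (if r \<le> j then \<Sum>i\<in>S k. A $$ (i, parent j) else 0)))"
    (is "similar_mat A ?B")
proof -
  define V W :: "'a mat" where
    "V = mat n n (\<lambda>(i, j). of_bool (i = j) - of_bool (r \<le> j \<and> i = parent j))"
    and "W = mat n n (\<lambda>(k, i). of_bool (i \<in> S k))"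
  have carr: "V \<in> carrier_mat n n" "W \<in> carrier_mat n n" by (simp_all add: V_def W_def)
  have mult_V: "(M * V) $$ (k, j) = M $$ (k, j) - (if r \<le> j then M $$ (k, parent j) else 0)"
    if "M \<in> carrier_mat n n" "k < n" "j < n" for M :: "'a mat" and k j
  proof -
    have "(M * V) $$ (k, j) = (\<Sum>i<n. M $$ (k, i) * of_bool (i = j)
        - M $$ (k, i) * of_bool (r \<le> j \<and> i = parent j))"
      using that by (simp add: V_def scalar_prod_def atLeast0LessThan right_diff_distrib)
    also have "\<dots> = (\<Sum>i\<in>{..<n} \<inter> {i. i = j}. M $$ (k, i))
        - (\<Sum>i\<in>{..<n} \<inter> {i. r \<le> j \<and> i = parent j}. M $$ (k, i))"
      by (simp add: sum_subtractf sum_mult_of_bool_eq)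
    also have "{..<n} \<inter> {i. i = j} = {j}" using that by auto
    also have "{..<n} \<inter> {i. r \<le> j \<and> i = parent j} = (if r \<le> j then {parent j} else {})"
      using that parent[of j] by auto
    also have "(\<Sum>i\<in>{j}. M $$ (k, i)) - (\<Sum>i\<in>(if r \<le> j then {parent j} else {}). M $$ (k, i))
        = M $$ (k, j) - (if r \<le> j then M $$ (k, parent j) else 0)"
      by simp
    finally show ?thesis .
  qed
  have W_mult: "(W * M) $$ (k, j) = (\<Sum>i\<in>S k. M $$ (i, j))"
    if "M \<in> carrier_mat n n" "k < n" "j < n" for M :: "'a mat" and k j
  proof -
    have "(W * M) $$ (k, j) = (\<Sum>i<n. of_bool (i \<in> S k) * M $$ (i, j))"
      using that by (simp add: W_def scalar_prod_def atLeast0LessThan)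
    also have "\<dots> = (\<Sum>i\<in>{..<n} \<inter> S k. M $$ (i, j))"
      by (simp add: sum.inter_restrict of_bool_def if_distrib[of "\<lambda>c. c * _"] cong: if_cong)
    finally show ?thesis using sub[OF \<open>k < n\<close>] by (simp add: Int_absorb1)
  qed
  \<comment> \<open>A non-root has exactly one ancestor more than its parent, namely itself.\<close>
  have WV: "W * V = 1\<^sub>m n"
  proof (rule eq_matI)
    fix k j assume "k < dim_row (1\<^sub>m n)" "j < dim_col (1\<^sub>m n)"
    then have kj: "k < n" "j < n" by auto
    show "(W * V) $$ (k, j) = 1\<^sub>m n $$ (k, j)"
      using kj parent[of j] self[of j] parent_notin[of j] step[of j k]
      unfolding mult_V[OF carr(2) kj] by (auto simp: W_def of_bool_def)
  qed (use carr in auto)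
  have VW: "V * W = 1\<^sub>m n"
    by (rule mat_mult_left_right_inverse[OF carr(2,1) WV])
  have B: "?B = W * A * V"
  proof (rule eq_matI)
    fix k j assume "k < dim_row (W * A * V)" "j < dim_col (W * A * V)"
    then have kj: "k < n" "j < n" using carr by auto
    show "?B $$ (k, j) = (W * A * V) $$ (k, j)"
      unfolding mult_V[OF mult_carrier_mat[OF carr(2) A] kj]
      using kj parent[of j] by (simp add: W_mult[OF A] del: index_mult_mat)
  qed (use carr in auto)
  have "V * ?B * W = (V * W) * A * (V * W)"
    unfolding B using A carr by (simp add: assoc_mult_mat[of _ n n _ n _ n])
  then have "A = V * ?B * W" using A by (simp add: VW)
  then show ?thesis using A carr VW WV by (intro similar_matI[of _ _ V W n]) auto
qed

lemma sum_eigenvalues_mset_factorized: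
  fixes A :: "real mat"
  assumes A: "A \<in> carrier_mat n n"
    and factorized: "char_poly A = (\<Prod>k\<in>I. [:- e k, 1:])"
  shows "(\<Sum>l\<in>#eigenvalues_mset A. f l) = (\<Sum>k\<in>I. f (complex_of_real (e k)))"
proof -
  interpret complex_poly: map_poly_comm_ring_hom complex_of_real ..
  have "char_poly (map_mat complex_of_real A) = map_poly complex_of_real (char_poly A)"
    by (rule of_real_hom.char_poly_hom[OF A])
  also have "\<dots> = (\<Prod>k\<in>I. [:- complex_of_real (e k), 1:])"
    unfolding factorized by (simp add: complex_poly.hom_prod)
  finally have "eigenvalues_mset A = (\<Sum>k\<in>I. {#complex_of_real (e k)#})"
    unfolding eigenvalues_mset_def by (simp add: proots_prod)
  then show ?thesis
    by (simp add: sum_unfold_sum_mset image_mset.compositionality o_def)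
qed

section \<open>Counting edges\<close>

text \<open>
  Since there are no loops, every undirected edge comes from exactly two arcs.
\<close>

lemma card_uedges_pair_graph:
  assumes "pair_graph G"
  shows "2 * card (uedges G) = (\<Sum>v\<in>pverts G. out_degree (with_proj G) v)"
proof -
  interpret pair_graph G by fact
  have sym: "(v, u) \<in> parcs G" if "(u, v) \<in> parcs G" for u v
    using that arcs_symmetric by auto
  have fin: "finite (parcs G)" by simp
  have fin_edges: "finite (uedges G)"
  proof -
    have "uedges G = (\<lambda>(u, v). {u, v}) ` parcs G" by (fastforce simp: uedges_def)
    then show ?thesis using fin by simp
  qed
  have "card (parcs G) = (\<Sum>e\<in>uedges G. card {a \<in> parcs G. {fst a, snd a} = e})"
  proof -
    have "parcs G = (\<Union>e\<in>uedges G. {a \<in> parcs G. {fst a, snd a} = e})"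
      by (fastforce simp: uedges_def)
    then have "card (parcs G) = card (\<Union>e\<in>uedges G. {a \<in> parcs G. {fst a, snd a} = e})" by simp
    also have "\<dots> = (\<Sum>e\<in>uedges G. card {a \<in> parcs G. {fst a, snd a} = e})"
      using fin_edges fin by (intro card_UN_disjoint) auto
    finally show ?thesis .
  qed
  also have "\<dots> = (\<Sum>e\<in>uedges G. 2)"
  proof (rule sum.cong)
    fix e assume "e \<in> uedges G"
    then obtain u v where e: "e = {u, v}" "(u, v) \<in> parcs G" by (auto simp: uedges_def)
    then have "u \<noteq> v" using no_loops' by auto
    moreover have "{a \<in> parcs G. {fst a, snd a} = e} = {(u, v), (v, u)}"
      using e sym by (auto simp: doubleton_eq_iff)
    ultimately show "card {a \<in> parcs G. {fst a, snd a} = e} = 2" by simp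
  qed simp
  finally have "2 * card (uedges G) = card (parcs G)" by simp
  also have "\<dots> = card (\<Union>v\<in>pverts G. out_arcs (with_proj G) v)"
    by (rule arg_cong[of _ _ card]) (auto simp: out_arcs_def dest: wellformed)
  also have "\<dots> = (\<Sum>v\<in>pverts G. out_degree (with_proj G) v)"
    unfolding out_degree_def
    by (rule card_UN_disjoint) (auto simp: out_arcs_def)
  finally show ?thesis .
qed

section \<open>The matrix of residues modulo an odd number\<close>

lemma card_minus_singleton:
  assumes "finite A"
  shows "real (card (A - {e})) = real (card A) - of_bool (e \<in> A)"
  using card.remove[OF assms, of e] by (cases "e \<in> A") auto

lemma sum_mod_lessThan_mult:
  fixes f :: "nat \<Rightarrow> 'a::semiring_1"
  shows "(\<Sum>i<p * q. f (i mod p)) = of_nat q * (\<Sum>r<p. f r)"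
proof -
  have "(\<Sum>i<p * q. f (i mod p)) = (\<Sum>t<q. \<Sum>i = t * p..<t * p + p. f (i mod p))"
    by (simp add: sum.nat_group mult.commute)
  also have "\<dots> = (\<Sum>t<q. \<Sum>r<p. f r)"
  proof (rule sum.cong)
    fix t
    have "(\<Sum>i = 0 + t * p..<p + t * p. f (i mod p)) = (\<Sum>r = 0..<p. f ((r + t * p) mod p))"
      by (rule sum.shift_bounds_nat_ivl)
    then show "(\<Sum>i = t * p..<t * p + p. f (i mod p)) = (\<Sum>r<p. f r)"
      by (simp add: add.commute atLeast0LessThan)
  qed simp
  finally show ?thesis by simp
qed

lemma dvd_add_residues:
  fixes p :: nat
  assumes "r < p" "j < p"
  shows "p dvd r + j \<longleftrightarrow> r + j = 0 \<or> r + j = p"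
proof
  assume "p dvd r + j"
  then obtain c where c: "r + j = p * c" by (auto simp: dvd_def)
  have "p * c < p * 2" using assms c by linarith
  then have "c = 0 \<or> c = 1" by (auto simp: less_2_cases_iff)
  then show "r + j = 0 \<or> r + j = p" using c by auto
qed auto

text \<open>
  The matrix of the introduction for an odd \<open>p\<close> and arbitrary reals \<open>\<mu>\<close> and \<open>\<beta>\<close>. Oddness ensures
  that no nonzero residue is its own opposite.
\<close>

locale residue_matrix =
  fixes p q :: nat and \<mu> \<beta> :: real
  assumes odd_p: "odd p" and p_ge: "3 \<le> p" and q_pos: "0 < q"
begin

definition residue_mat :: "real mat" where
  "residue_mat = mat (p * q) (p * q) (\<lambda>(i, j).
     of_bool (i = j) * (\<mu> - of_bool (\<not> p dvd j)) + \<beta> * of_bool (\<not> p dvd i + j))"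

definition half :: nat where "half = p div 2"

text \<open>
  The three cases perform the three reductions: to residues, to residues up to sign, and to the two
  classes of zero and of nonzero residues. The indices \<open>0\<close> and \<open>1\<close> are the roots.
\<close>

definition parent :: "nat \<Rightarrow> nat" where
  "parent j = (if p \<le> j then j mod p else if half < j then p - j else 1)"

text \<open>
  The set \<open>below k\<close> collects the descendants of \<open>k\<close> for \<^const>\<open>parent\<close>. For \<open>k < p\<close> it is a union of
  residue classes, those of the residues that descend from \<open>k\<close>.
\<close>

definition residues_below :: "nat \<Rightarrow> nat set" where
  "residues_below k =
     (if k = 0 then {0} else if k = 1 then {1..<p} else if k \<le> half then {k, p - k} else {k})"

definition below :: "nat \<Rightarrow> nat set" where
  "below k = (if k < p then {i. i < p * q \<and> i mod p \<in> residues_below k} else {k})"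

text \<open>
  The eigenvalues for the three kinds of differences: within a residue class, of opposite residues,
  and of residues in the lower half.
\<close>

definition diagonal_entry :: "nat \<Rightarrow> real" where
  "diagonal_entry k =
     (if p \<le> k then \<mu> - of_bool (\<not> p dvd k)
      else if half < k then \<mu> - 1 + \<beta> * q else \<mu> - 1 - \<beta> * q)"

lemma p_eq: "p = 2 * half + 1" and half_ge: "1 \<le> half"
  using odd_p p_ge by (auto simp: half_def elim: oddE)

lemma p_le_mult: "p \<le> p * q"
  using q_pos by simp

lemma residues_below_subset: "k < p \<Longrightarrow> residues_below k \<subseteq> {..<p}"
  using half_ge p_eq by (auto simp: residues_below_def)

text \<open>
  The matrix of the linear map given by \<^const>\<open>residue_mat\<close>, in the basis of differences to parents.
\<close>

definition difference_form :: "real mat" where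
  "difference_form = mat (p * q) (p * q) (\<lambda>(k, j).
    (\<Sum>i\<in>below k. residue_mat $$ (i, j))
    - (if 2 \<le> j then \<Sum>i\<in>below k. residue_mat $$ (i, parent j) else 0))"

lemma similar_residue_mat_difference_form: "similar_mat residue_mat difference_form"
  unfolding difference_form_def
proof (rule similar_mat_differences_to_parents)
  have parent_less: "parent j < p" for j
    using p_ge half_ge p_eq by (auto simp: parent_def)
  show "residue_mat \<in> carrier_mat (p * q) (p * q)"
    by (simp add: residue_mat_def)
  show "parent j < p * q" for j
    using parent_less[of j] p_le_mult by linarith
  show "below k \<subseteq> {..<p * q}" if "k < p * q" for k
    using that by (auto simp: below_def)
  show "j \<in> below j" if "j < p * q" for j
    using that by (auto simp: below_def residues_below_def)
  have mod_neq: "j mod p \<noteq> j" if "p \<le> j" for j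
    using that mod_less_divisor[of p j] p_ge by linarith
  show "parent j \<notin> below j" if "2 \<le> j" "j < p * q" for j
    using that parent_less[of j] p_eq half_ge mod_neq[of j]
    by (auto simp: below_def residues_below_def parent_def split: if_splits)
  show "j \<in> below k \<longleftrightarrow> 2 \<le> j \<and> parent j \<in> below k"
    if "j < p * q" "k < p * q" "k \<noteq> j" for j k
  proof -
    consider "p \<le> k" | "k < p" "p \<le> j" | "k < p" "j < p" by linarith
    then show ?thesis
    proof cases
      case 1
      then show ?thesis using that parent_less[of j] by (auto simp: below_def)
    next
      case 2
      have "j mod p < p * q" using less_le_trans[OF parent_less[of j] p_le_mult] 2
        by (simp add: parent_def)
      then show ?thesis using that 2 p_ge by (auto simp: below_def parent_def)
    next
      case 3
      then have "j \<in> residues_below k \<longleftrightarrow> 2 \<le> j \<and> parent j \<in> residues_below k"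
        using \<open>k \<noteq> j\<close> p_eq half_ge
        by (auto simp: residues_below_def parent_def split: if_splits)
      moreover have "parent j < p * q" using parent_less[of j] p_le_mult by linarith
      ultimately show ?thesis using that 3 parent_less[of j]
        by (simp add: below_def)
    qed
  qed
qed

text \<open>
  Exactly one residue is opposite to \<open>j\<close>, so the number of residues below \<open>k\<close> that are not opposite
  to \<open>j\<close> is their total number, reduced by one if the opposite of \<open>j\<close> is among them.
\<close>

lemma sum_residues_below_not_opposite:
  assumes "k < p" "j < p"
  shows "(\<Sum>r<p. of_bool (r \<in> residues_below k) * of_bool (\<not> p dvd r + j) :: real) =
    (if k = 0 then of_bool (j \<noteq> 0)
     else if k = 1 then p - 1 - of_bool (j \<noteq> 0)
     else if k \<le> half then 2 - of_bool (j = k \<or> j = p - k)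
     else 1 - of_bool (j = p - k))"
proof -
  have sub: "residues_below k \<subseteq> {..<p}" by (rule residues_below_subset[OF assms(1)])
  have "(\<Sum>r<p. of_bool (r \<in> residues_below k) * of_bool (\<not> p dvd r + j) :: real)
      = (\<Sum>r<p. of_bool (r \<in> residues_below k \<and> \<not> p dvd r + j))"
    by (rule sum.cong) auto
  also have "\<dots> = card (residues_below k - {r. p dvd r + j})"
  proof -
    have "{..<p} \<inter> {r. r \<in> residues_below k \<and> \<not> p dvd r + j} = residues_below k - {r. p dvd r + j}"
      using sub by auto
    then show ?thesis by simp
  qed
  also have "residues_below k - {r. p dvd r + j} =
      residues_below k - {if j = 0 then 0 else p - j}"
  proof -
    have "p dvd r + j \<longleftrightarrow> r = (if j = 0 then 0 else p - j)" if "r \<in> residues_below k" for r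
      using that sub assms dvd_add_residues[of r p j] by auto
    then show ?thesis by blast
  qed
  also have "real (card \<dots>) = real (card (residues_below k))
      - of_bool ((if j = 0 then 0 else p - j) \<in> residues_below k)"
  proof -
    have "finite (residues_below k)" using sub finite_subset by blast
    then show ?thesis by (rule card_minus_singleton)
  qed
  also have "\<dots> = (if k = 0 then of_bool (j \<noteq> 0)
     else if k = 1 then p - 1 - of_bool (j \<noteq> 0)
     else if k \<le> half then 2 - of_bool (j = k \<or> j = p - k)
     else 1 - of_bool (j = p - k))"
    using assms p_eq half_ge by (auto simp: residues_below_def of_nat_diff)
  finally show ?thesis .
qed

text \<open>
  Every residue class has \<open>q\<close> elements, so the off-diagonal part of a column sums to \<open>\<beta> * q\<close> times
  the number of residues below \<open>k\<close> that are not opposite to \<open>j\<close>.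
\<close>

lemma sum_below:
  assumes "k < p" "j < p * q"
  shows "(\<Sum>i\<in>below k. residue_mat $$ (i, j)) =
    of_bool (j \<in> below k) * (\<mu> - of_bool (\<not> p dvd j))
    + \<beta> * q * (if k = 0 then of_bool (j mod p \<noteq> 0)
     else if k = 1 then p - 1 - of_bool (j mod p \<noteq> 0)
     else if k \<le> half then 2 - of_bool (j mod p = k \<or> j mod p = p - k)
     else 1 - of_bool (j mod p = p - k))"
proof -
  have below: "below k = {..<p * q} \<inter> {i. i mod p \<in> residues_below k}"
    using assms by (auto simp: below_def)
  have dvd: "p dvd i + j \<longleftrightarrow> p dvd i mod p + j mod p" for i
    by (simp add: dvd_eq_mod_eq_0 mod_add_eq)
  have "(\<Sum>i\<in>below k. residue_mat $$ (i, j)) = (\<Sum>i\<in>below k. of_bool (i = j)) * (\<mu> - of_bool (\<not> p dvd j))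
      + \<beta> * (\<Sum>i\<in>below k. of_bool (\<not> p dvd i + j))"
    using assms(2) by (simp add: residue_mat_def below sum.distrib sum_distrib_left sum_distrib_right)
  also have "(\<Sum>i\<in>below k. of_bool (i = j)) = (of_bool (j \<in> below k) :: real)"
    by (simp add: below of_bool_def)
  also have "(\<Sum>i\<in>below k. of_bool (\<not> p dvd i + j))
      = (\<Sum>i<p * q. of_bool (i mod p \<in> residues_below k) * of_bool (\<not> p dvd i mod p + j mod p) :: real)"
  proof -
    have "(\<Sum>i\<in>below k. of_bool (\<not> p dvd i + j))
      = (\<Sum>i<p * q. if i \<in> {i. i mod p \<in> residues_below k} then of_bool (\<not> p dvd i + j) else 0 :: real)"
      unfolding below by (rule sum.inter_restrict) simp
    also have "\<dots> = (\<Sum>i<p * q. of_bool (i mod p \<in> residues_below k)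
        * of_bool (\<not> p dvd i mod p + j mod p))"
      by (rule sum.cong[OF refl]) (simp only: dvd mem_Collect_eq of_bool_def mult_1_left mult_zero_left
        split: if_split, simp)
    finally show ?thesis .
  qed
  also have "\<dots> = real q * (\<Sum>r<p. of_bool (r \<in> residues_below k) * of_bool (\<not> p dvd r + j mod p))"
    by (rule sum_mod_lessThan_mult)
  also have "(\<Sum>r<p. of_bool (r \<in> residues_below k) * of_bool (\<not> p dvd r + j mod p) :: real) =
    (if k = 0 then of_bool (j mod p \<noteq> 0)
     else if k = 1 then p - 1 - of_bool (j mod p \<noteq> 0)
     else if k \<le> half then 2 - of_bool (j mod p = k \<or> j mod p = p - k)
     else 1 - of_bool (j mod p = p - k))"
    using assms(1) p_ge by (intro sum_residues_below_not_opposite) auto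
  finally show ?thesis by (simp only: mult.assoc)
qed

lemma difference_form_leading_block:
  "difference_form $$ (0, 0) = \<mu>"
  "difference_form $$ (0, 1) = \<beta> * q"
  "difference_form $$ (1, 0) = \<beta> * q * (real p - 1)"
  "difference_form $$ (1, 1) = \<mu> - 1 + \<beta> * q * (real p - 2)"
proof -
  have lt: "0 < p * q" "1 < p * q" "0 < p" "1 < p" using p_le_mult p_ge by linarith+
  have "\<not> p dvd 1" using p_ge by auto
  with lt p_ge show "difference_form $$ (0, 0) = \<mu>"
    "difference_form $$ (0, 1) = \<beta> * q"
    "difference_form $$ (1, 0) = \<beta> * q * (real p - 1)"
    "difference_form $$ (1, 1) = \<mu> - 1 + \<beta> * q * (real p - 2)"
    by (simp_all add: difference_form_def sum_below)
      (auto simp: below_def residues_below_def algebra_simps)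
qed

text \<open>
  In each of the three cases for \<open>j\<close> the sums over \<open>below k\<close> of the columns \<open>j\<close> and \<open>parent j\<close> agree
  for \<open>k < j\<close>. Since \<open>below k\<close> then contains both \<open>j\<close> and its parent or neither of them, the diagonal
  terms cancel. If \<open>j \<ge> p\<close>, the remaining terms of the two columns are the same. If \<open>half < j < p\<close>,
  the columns belong to opposite residues, and for \<open>k < j\<close> the residues below \<open>k\<close> are closed under
  taking opposites or contain neither \<open>j\<close> nor \<open>p - j\<close>. If \<open>2 \<le> j \<le> half\<close>, the parent is \<open>1\<close>, and
  the residues below \<open>k < j\<close> contain both or none of the opposites of \<open>j\<close> and \<open>1\<close>. For \<open>k = j\<close>
  just one of the two opposites is below \<open>k\<close> in the last two cases, whence the terms \<open>\<plusminus> \<beta> * q\<close>.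
\<close>

lemma difference_form_beyond_leading_block:
  assumes kj: "k \<le> j" and j: "2 \<le> j" "j < p * q"
  shows "difference_form $$ (k, j) = (if k = j then diagonal_entry j else 0)"
proof -
  have "parent j < p" using p_ge half_ge p_eq by (auto simp: parent_def)
  then have parent: "parent j < p" "parent j < p * q"
    using p_le_mult by linarith+
  have dvd: "p dvd parent j \<longleftrightarrow> p dvd j"
  proof (cases "p \<le> j")
    case False
    then have "0 < parent j" "0 < j" using j half_ge by (auto simp: parent_def)
    then show ?thesis using False parent nat_dvd_not_less[of j p] nat_dvd_not_less[of "parent j" p]
      by auto
  qed (simp add: parent_def dvd_mod_iff)
  have entry: "difference_form $$ (k, j) = (\<Sum>i\<in>below k. residue_mat $$ (i, j))
      - (\<Sum>i\<in>below k. residue_mat $$ (i, parent j))"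
    using kj j by (simp add: difference_form_def)
  have not_dvd: "j < p \<Longrightarrow> \<not> p dvd j"
    using j nat_dvd_not_less[of j p] by simp
  consider "p \<le> k" | "k < p" "p \<le> j" | "k < p" "j < p" by linarith
  then show ?thesis
  proof cases
    case 1
    then have pj: "p \<le> j" and k: "k < p * q" using kj j by linarith+
    have "p dvd k + parent j \<longleftrightarrow> p dvd k + j"
      using pj by (simp add: parent_def dvd_eq_mod_eq_0 mod_add_right_eq)
    moreover have "k \<noteq> parent j" using 1 parent by linarith
    ultimately have "difference_form $$ (k, j) = of_bool (k = j) * (\<mu> - of_bool (\<not> p dvd j))"
      using 1 k j parent unfolding entry by (simp add: below_def residue_mat_def)
    then show ?thesis using pj by (simp add: diagonal_entry_def)
  next
    case 2
    have "parent j mod p = j mod p" using 2 by (simp add: parent_def)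
    moreover from this have "parent j \<in> below k \<longleftrightarrow> j \<in> below k"
      using 2 j parent by (simp add: below_def)
    ultimately have "difference_form $$ (k, j) = 0"
      unfolding entry sum_below[OF 2(1) j(2)] sum_below[OF 2(1) parent(2)] dvd by simp
    then show ?thesis using 2 by simp
  next
    case 3
    have mods: "parent j mod p = parent j" "j mod p = j" using 3 parent by simp_all
    have below: "i \<in> below k \<longleftrightarrow> i \<in> residues_below k" if "i < p" for i
      using that 3 less_le_trans[OF that p_le_mult] by (simp add: below_def)
    have entry': "difference_form $$ (k, j) =
        (of_bool (j \<in> residues_below k) - of_bool (parent j \<in> residues_below k)) * (\<mu> - 1)
        + \<beta> * q * (if k = 0 then of_bool (j \<noteq> 0) - of_bool (parent j \<noteq> 0)
          else if k = 1 then of_bool (parent j \<noteq> 0) - of_bool (j \<noteq> 0)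
          else if k \<le> half then of_bool (parent j = k \<or> parent j = p - k) - of_bool (j = k \<or> j = p - k)
          else of_bool (parent j = p - k) - of_bool (j = p - k))"
      unfolding entry sum_below[OF 3(1) j(2)] sum_below[OF 3(1) parent(2)] dvd mods
        below[OF 3(2)] below[OF parent(1)]
      using not_dvd[OF 3(2)] 3(1) by (cases "k = 0"; cases "k = 1") (simp_all add: algebra_simps)
    consider "j \<le> half" | "half < j" by linarith
    then show ?thesis
    proof cases
      case 1
      then have "parent j = 1" using 3 by (simp add: parent_def)
      moreover have "k = 0 \<or> k = 1 \<or> 2 \<le> k \<and> k \<le> half" using 1 kj by linarith
      ultimately show ?thesis
        unfolding entry' using 1 3 kj j p_eq
        by (elim disjE) (simp_all add: residues_below_def diagonal_entry_def, auto)
    next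
      case 2
      then have "parent j = p - j" using 3 by (simp add: parent_def)
      moreover have "k = 0 \<or> k = 1 \<or> 2 \<le> k \<and> k \<le> half \<or> half < k" by linarith
      ultimately show ?thesis
        unfolding entry' using 2 3 kj j p_eq half_ge
        by (elim disjE) (simp_all add: residues_below_def diagonal_entry_def, auto)
    qed
  qed
qed

lemma char_poly_residue_mat:
  "char_poly residue_mat =
    [:\<mu> * (\<mu> - 1 + \<beta> * q * (real p - 2)) - (\<beta> * q)\<^sup>2 * (real p - 1),
      - (2 * \<mu> - 1 + \<beta> * q * (real p - 2)), 1:]
    * (\<Prod>k = 2..<p * q. [:- diagonal_entry k, 1:])"
proof -
  have "char_poly residue_mat = char_poly difference_form"
    by (rule char_poly_similar[OF similar_residue_mat_difference_form])
  also have "\<dots> = [:difference_form $$ (0, 0) * difference_form $$ (1, 1)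
        - difference_form $$ (0, 1) * difference_form $$ (1, 0),
      - (difference_form $$ (0, 0) + difference_form $$ (1, 1)), 1:]
    * (\<Prod>k = 2..<p * q. [:- difference_form $$ (k, k), 1:])"
  proof (rule char_poly_block_lower_triangular_2)
    show "difference_form \<in> carrier_mat (p * q) (p * q)" by (simp add: difference_form_def)
    show "2 \<le> p * q" using p_le_mult p_ge by linarith
  qed (simp add: difference_form_beyond_leading_block)
  also have "(\<Prod>k = 2..<p * q. [:- difference_form $$ (k, k), 1:])
      = (\<Prod>k = 2..<p * q. [:- diagonal_entry k, 1:])"
    by (rule prod.cong) (simp_all add: difference_form_beyond_leading_block)
  finally show ?thesis
    by (simp only: difference_form_leading_block) (simp add: algebra_simps power2_eq_square)
qed

text \<open>
  The indices from \<open>p\<close> on run \<open>q - 1\<close> times through all residues; the multiplicities \<open>(p - 3) / 2\<close> and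
  \<open>(p - 1) / 2\<close> count the indices \<open>2, \<dots>, half\<close> and \<open>half + 1, \<dots>, p - 1\<close>.
\<close>

lemma sum_diagonal_entry:
  fixes F :: "real \<Rightarrow> real"
  shows "(\<Sum>k = 2..<p * q. F (diagonal_entry k)) =
    (real p - 3) / 2 * F (\<mu> - 1 - \<beta> * q) + (real p - 1) / 2 * F (\<mu> - 1 + \<beta> * q)
    + (real q - 1) * (F \<mu> + (real p - 1) * F (\<mu> - 1))"
proof -
  have real_p: "real p = 2 * real half + 1" using arg_cong[OF p_eq, of real] by simp
  define f where "f r = F (\<mu> - of_bool (r \<noteq> 0))" for r :: nat
  have "(\<Sum>k = 2..<p * q. F (diagonal_entry k)) = (\<Sum>k = 2..<half + 1. F (diagonal_entry k))
      + (\<Sum>k = half + 1..<p. F (diagonal_entry k)) + (\<Sum>k = p..<p * q. F (diagonal_entry k))"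
  proof -
    have "2 \<le> half + 1" "half + 1 \<le> p" "2 \<le> p" using p_eq half_ge by linarith+
    then show ?thesis using p_le_mult by (simp only: sum.atLeastLessThan_concat)
  qed
  also have "(\<Sum>k = 2..<half + 1. F (diagonal_entry k)) = (\<Sum>k = 2..<half + 1. F (\<mu> - 1 - \<beta> * q))"
    using p_eq by (intro sum.cong) (auto simp: diagonal_entry_def)
  also have "(\<Sum>k = half + 1..<p. F (diagonal_entry k)) = (\<Sum>k = half + 1..<p. F (\<mu> - 1 + \<beta> * q))"
    by (intro sum.cong) (auto simp: diagonal_entry_def)
  also have "(\<Sum>k = p..<p * q. F (diagonal_entry k)) = (\<Sum>k = p..<p * q. f (k mod p))"
    by (intro sum.cong) (auto simp: diagonal_entry_def f_def dvd_eq_mod_eq_0)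
  also have "\<dots> = (\<Sum>k<p * q. f (k mod p)) - (\<Sum>k<p. f (k mod p))"
    using sum.atLeastLessThan_concat[of 0 p "p * q" "\<lambda>k. f (k mod p)"] p_le_mult
    by (simp add: atLeast0LessThan)
  also have "\<dots> = (real q - 1) * (\<Sum>r<p. f r)"
    by (simp add: sum_mod_lessThan_mult algebra_simps)
  also have "(\<Sum>r<p. f r) = F \<mu> + (real p - 1) * F (\<mu> - 1)"
  proof -
    have "{..<p} = insert 0 {1..<p}" using p_ge by auto
    then have "(\<Sum>r<p. f r) = f 0 + (\<Sum>r = 1..<p. f r)" by simp
    also have "(\<Sum>r = 1..<p. f r) = (\<Sum>r = 1..<p. F (\<mu> - 1))"
      by (rule sum.cong) (auto simp: f_def)
    finally show ?thesis using p_ge by (simp add: f_def of_nat_diff)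
  qed
  also have "(\<Sum>k = 2..<half + 1. F (\<mu> - 1 - \<beta> * q)) = (real p - 3) / 2 * F (\<mu> - 1 - \<beta> * q)"
    using half_ge by (simp only: sum_constant card_atLeastLessThan real_p) (simp add: of_nat_diff)
  also have "(\<Sum>k = half + 1..<p. F (\<mu> - 1 + \<beta> * q)) = (real p - 1) / 2 * F (\<mu> - 1 + \<beta> * q)"
  proof -
    have "p - (half + 1) = half" using p_eq by linarith
    then show ?thesis by (simp only: sum_constant card_atLeastLessThan real_p) simp
  qed
  finally show ?thesis .
qed

end

section \<open>The graph of a prime power\<close>

lemma coprime_prime_iff:
  fixes p :: nat
  assumes "prime p"
  shows "coprime a p \<longleftrightarrow> \<not> p dvd a"
  using assms prime_imp_coprime[of p a] coprime_absorb_left[of p a] not_prime_unit[of p]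
  by (auto simp: coprime_commute)

lemma dvd_double_iff:
  fixes p :: nat
  assumes "prime p" "odd p"
  shows "p dvd a + a \<longleftrightarrow> p dvd a"
proof -
  have "\<not> p dvd 2" using assms primes_dvd_imp_eq[of p 2] by (auto simp: two_is_prime_nat)
  then show ?thesis using assms(1) by (simp add: prime_dvd_mult_iff flip: mult_2)
qed

text \<open>
  There are \<open>p ^ m - p ^ (m - 1)\<close> vertices \<open>b\<close> for which \<open>a + b\<close> is a unit. The vertex \<open>a\<close> itself is one
  of them iff \<open>p\<close> does not divide \<open>a + a\<close>, and then it must not be counted.
\<close>

lemma out_degree_unitary_addition_Cayley_graph_prime_power:
  assumes p: "prime p" "odd p" and m: "0 < m" and a: "a < p ^ m"
  shows "real (out_degree (with_proj (unitary_addition_Cayley_graph (p ^ m))) a) =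
    real p ^ m - real p ^ (m - 1) - of_bool (\<not> p dvd a)"
proof -
  define T where "T = {..<p ^ m} \<inter> {b. \<not> p dvd a + b}"
  have power: "p ^ m = p * p ^ (m - 1)" using m by (cases m) simp_all
  have p_pos: "0 < p" using p(1) by (rule prime_gt_0_nat)
  have "out_arcs (with_proj (unitary_addition_Cayley_graph (p ^ m))) a = Pair a ` (T - {a})"
    using a m p(1)
    by (auto simp: out_arcs_def unitary_addition_Cayley_graph_def T_def coprime_prime_iff)
  then have deg: "out_degree (with_proj (unitary_addition_Cayley_graph (p ^ m))) a = card (T - {a})"
    by (simp add: out_degree_def card_image inj_on_def)
  have residue: "(\<Sum>r<p. of_bool (\<not> p dvd a mod p + r)) = real p - 1"
  proof -
    define s where "s = a mod p"
    have s: "s < p" using p_pos by (simp add: s_def)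
    have "{..<p} \<inter> {r. \<not> p dvd s + r} = {..<p} - {if s = 0 then 0 else p - s}"
      using s by (auto simp: dvd_add_residues split: if_splits)
    then have "card ({..<p} \<inter> {r. \<not> p dvd s + r}) = p - 1"
      using s by simp
    then show ?thesis using p_pos by (simp add: s_def of_nat_diff)
  qed
  have "real (card T) = (\<Sum>b<p ^ m. of_bool (\<not> p dvd a + b))"
    by (simp add: T_def)
  also have "\<dots> = (\<Sum>b<p * p ^ (m - 1). of_bool (\<not> p dvd a mod p + b mod p))"
    unfolding power[symmetric]
    by (rule sum.cong[OF refl]) (simp only: dvd_eq_mod_eq_0 mod_add_eq)
  also have "\<dots> = real (p ^ (m - 1)) * (real p - 1)"
    unfolding residue[symmetric] by (rule sum_mod_lessThan_mult)
  finally have card_T: "real (card T) = real p ^ m - real p ^ (m - 1)"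
    using arg_cong[OF power, of real] by (simp add: algebra_simps)
  have a_T: "a \<in> T \<longleftrightarrow> \<not> p dvd a"
    using a by (simp add: T_def dvd_double_iff[OF p])
  have "finite T" by (simp add: T_def)
  then have "real (card (T - {a})) = real (card T) - of_bool (\<not> p dvd a)"
    unfolding a_T[symmetric] by (rule card_minus_singleton)
  then show ?thesis by (simp add: deg card_T)
qed

lemma card_uedges_unitary_addition_Cayley_graph_prime_power:
  assumes p: "prime p" "odd p" and m: "0 < m"
  shows "2 * real (card (uedges (unitary_addition_Cayley_graph (p ^ m)))) =
    (real p ^ m - 1) * (real p ^ m - real p ^ (m - 1))"
proof -
  let ?G = "unitary_addition_Cayley_graph (p ^ m)"
  have power: "p ^ m = p * p ^ (m - 1)" using m by (cases m) simp_all
  have p_pos: "0 < p" using p(1) by (rule prime_gt_0_nat)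
  have nonmultiples: "(\<Sum>a<p ^ m. of_bool (\<not> p dvd a)) = real p ^ m - real p ^ (m - 1)"
  proof -
    have "(\<Sum>a<p ^ m. of_bool (\<not> p dvd a)) = (\<Sum>a<p * p ^ (m - 1). of_bool (a mod p \<noteq> 0) :: real)"
      by (simp only: power dvd_eq_mod_eq_0)
    also have "\<dots> = real (p ^ (m - 1)) * (\<Sum>r<p. of_bool (r \<noteq> 0))"
      by (rule sum_mod_lessThan_mult)
    also have "(\<Sum>r<p. of_bool (r \<noteq> 0)) = real p - 1"
    proof -
      have "{..<p} \<inter> {r. r \<noteq> 0} = {1..<p}" by auto
      then show ?thesis using p_pos by (simp add: of_nat_diff)
    qed
    finally show ?thesis
      using arg_cong[OF power, of real] by (simp add: algebra_simps)
  qed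
  have "2 * real (card (uedges ?G)) = real (2 * card (uedges ?G))" by simp
  also have "\<dots> = (\<Sum>a<p ^ m. real (out_degree (with_proj ?G) a))"
    unfolding card_uedges_pair_graph[OF pair_graph_unitary_addition_Cayley_graph]
    by (simp add: unitary_addition_Cayley_graph_def atLeast0LessThan)
  also have "\<dots> = (\<Sum>a<p ^ m. real p ^ m - real p ^ (m - 1) - of_bool (\<not> p dvd a))"
    by (rule sum.cong)
      (simp_all add: out_degree_unitary_addition_Cayley_graph_prime_power[OF p m])
  also have "\<dots> = (real p ^ m - 1) * (real p ^ m - real p ^ (m - 1))"
    by (simp add: sum_subtractf nonmultiples) (simp add: algebra_simps)
  finally show ?thesis .
qed

text \<open>
  The loop that is missing at \<open>j\<close> when \<open>p\<close> does not divide \<open>j\<close> contributes \<open>- \<alpha>\<close> through the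
  degree and \<open>- (1 - \<alpha>)\<close> through the adjacency, hence the diagonal correction \<open>- 1\<close>
  whatever \<open>\<alpha>\<close> is.
\<close>

lemma A_alpha_matrix_unitary_addition_Cayley_graph_prime_power:
  assumes p: "prime p" "odd p" and m: "0 < m"
  shows "A_alpha_matrix \<alpha> (unitary_addition_Cayley_graph (p ^ m)) =
    residue_matrix.residue_mat p (p ^ (m - 1)) (\<alpha> * (real p ^ m - real p ^ (m - 1))) (1 - \<alpha>)"
    (is "?A = _")
proof -
  let ?G = "unitary_addition_Cayley_graph (p ^ m)"
  have "3 \<le> p" using p prime_ge_2_nat[of p] by (cases "p = 2") auto
  moreover define q \<mu> where "q = p ^ (m - 1)" and "\<mu> = \<alpha> * (real p ^ m - real p ^ (m - 1))"
  ultimately interpret residue_matrix p q \<mu> "1 - \<alpha>"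
    using p by unfold_locales auto
  have power: "p * q = p ^ m" using m unfolding q_def by (cases m) simp_all
  have card: "card (pverts ?G) = p ^ m" by (simp add: unitary_addition_Cayley_graph_def)
  have at: "vertex_at ?G i = i" if "i < p ^ m" for i
    using that by (simp add: vertex_at_def unitary_addition_Cayley_graph_def)
  have arc: "(i, j) \<in> parcs ?G \<longleftrightarrow> i \<noteq> j \<and> \<not> p dvd i + j" if "i < p ^ m" "j < p ^ m" for i j
    using that p m by (simp add: unitary_addition_Cayley_graph_def coprime_prime_iff)
  note double = dvd_double_iff[OF p]
  have "?A = residue_mat"
  proof (rule eq_matI)
    fix i j assume "i < dim_row residue_mat" "j < dim_col residue_mat"
    then have ij: "i < p ^ m" "j < p ^ m" by (simp_all add: residue_mat_def power)
    then show "?A $$ (i, j) = residue_mat $$ (i, j)"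
      by (simp add: A_alpha_matrix_def degree_matrix_def adjacency_matrix_def card at arc
          residue_mat_def power double mat_diag_def
          out_degree_unitary_addition_Cayley_graph_prime_power[OF p m])
        (simp add: \<mu>_def algebra_simps)
  qed (simp_all add: A_alpha_matrix_def degree_matrix_def adjacency_matrix_def card
      residue_mat_def power mat_diag_def)
  then show ?thesis unfolding q_def \<mu>_def .
qed

theorem corollary3p1:
  fixes p m :: nat and \<alpha> x y :: real
  assumes "prime p" and "p \<ge> 3" and "m \<ge> 1" and "0 \<le> \<alpha>" and "\<alpha> < 1"
    and "x = (1 + \<alpha>) * real p ^ m - 2 * real p ^ (m - 1) - 1"
    and "y = sqrt ((1 - real p ^ m + \<alpha> * real p ^ m)\<^sup>2 + 4 * (1 - \<alpha>) * real p ^ (m - 1))"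
  shows "A_alpha_energy \<alpha> (unitary_addition_Cayley_graph (p ^ m)) =
      (3 * real p ^ m - 5 * real p ^ (m - 1) - real p - 1) / 2
    + \<alpha> / (2 * real p) * (- 3 * real p ^ (m + 1) + 9 * real p ^ m - 4 * real p ^ (m - 1)
        + (real p)\<^sup>2 - 2 * real p + 1)
    + (real p - 1) / (2 * real p) * \<bar>(real p ^ m - real p) * (1 - \<alpha>) - \<alpha>\<bar>
    + \<bar>(x - y) / 2 - \<alpha> * (real p ^ m - 1) * (real p - 1) / real p\<bar>
    + \<bar>(x + y) / 2 - \<alpha> * (real p ^ m - 1) * (real p - 1) / real p\<bar>"
proof -
  define q where "q = p ^ (m - 1)"
  have p: "prime p" "odd p" and m: "0 < m"
    using assms(1-3) primes_dvd_imp_eq[of 2 p] by (auto simp: two_is_prime_nat)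
  have power: "p ^ m = p * q" using m by (cases m) (simp_all add: q_def)
  define P Q where "P = real p" and "Q = real q"
  have real_power: "real p ^ m = P * Q" "real p ^ (m - 1) = Q" "real p ^ (m + 1) = P * P * Q"
    using arg_cong[OF power, of real] by (simp_all add: P_def Q_def q_def)
  have P: "3 \<le> P" and Q: "1 \<le> Q"
    using assms(2) by (simp_all add: P_def Q_def q_def)
  define \<mu> where "\<mu> = \<alpha> * (P * Q - Q)"
  interpret residue_matrix p q \<mu> "1 - \<alpha>"
    using p assms(2) by unfold_locales (auto simp: q_def)
  let ?G = "unitary_addition_Cayley_graph (p ^ m)"
  have A: "A_alpha_matrix \<alpha> ?G = residue_mat"
    unfolding A_alpha_matrix_unitary_addition_Cayley_graph_prime_power[OF p m] \<mu>_def real_power q_def ..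
  define e where "e k = (if k = 0 then (x - y) / 2 else if k = 1 then (x + y) / 2 else diagonal_entry k)"
    for k
  have split: "{..<p * q} = insert 0 (insert 1 {2..<p * q})"
  proof -
    have "0 < p * q" "1 < p * q" using p_le_mult p_ge by linarith+
    then show ?thesis by auto
  qed
  have factorized: "char_poly residue_mat = (\<Prod>k<p * q. [:- e k, 1:])"
  proof -
    \<comment> \<open>The numbers \<open>x\<close> and \<open>y\<^sup>2\<close> are the trace and the discriminant of the leading block.\<close>
    have x: "x = 2 * \<mu> - 1 + (1 - \<alpha>) * Q * (P - 2)"
      unfolding assms(6) real_power \<mu>_def by (simp add: algebra_simps)
    have "y\<^sup>2 = (1 - P * Q + \<alpha> * (P * Q))\<^sup>2 + 4 * (1 - \<alpha>) * Q"
      using assms(5) Q unfolding assms(7) real_power by (intro real_sqrt_pow2) simp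
    then have "x\<^sup>2 - y\<^sup>2 = 4 * (\<mu> * (\<mu> - 1 + (1 - \<alpha>) * Q * (P - 2)) - ((1 - \<alpha>) * Q)\<^sup>2 * (P - 1))"
      unfolding x \<mu>_def by (simp add: power2_eq_square algebra_simps)
    moreover have "(x - y) / 2 * ((x + y) / 2) = (x\<^sup>2 - y\<^sup>2) / 4"
      by (simp add: power2_eq_square field_simps)
    ultimately have "(x - y) / 2 * ((x + y) / 2)
        = \<mu> * (\<mu> - 1 + (1 - \<alpha>) * Q * (P - 2)) - ((1 - \<alpha>) * Q)\<^sup>2 * (P - 1)"
      by simp
    moreover have "(x - y) / 2 + (x + y) / 2 = 2 * \<mu> - 1 + (1 - \<alpha>) * Q * (P - 2)"
      unfolding x by (simp add: field_simps)
    moreover have "[:- ((x - y) / 2), 1:] * [:- ((x + y) / 2), 1:]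
        = [:(x - y) / 2 * ((x + y) / 2), - ((x - y) / 2 + (x + y) / 2), 1:]"
      by simp
    ultimately have "[:- ((x - y) / 2), 1:] * [:- ((x + y) / 2), 1:]
        = [:\<mu> * (\<mu> - 1 + (1 - \<alpha>) * Q * (P - 2)) - ((1 - \<alpha>) * Q)\<^sup>2 * (P - 1),
            - (2 * \<mu> - 1 + (1 - \<alpha>) * Q * (P - 2)), 1:]"
      by simp
    moreover have "(\<Prod>k = 2..<p * q. [:- e k, 1:]) = (\<Prod>k = 2..<p * q. [:- diagonal_entry k, 1:])"
      by (rule prod.cong) (auto simp: e_def)
    ultimately show ?thesis
      unfolding char_poly_residue_mat split
      by (simp add: e_def P_def Q_def mult.assoc del: mult_pCons_left mult_pCons_right)
  qed
  define c where "c = \<alpha> * (P * Q - 1) * (P - 1) / P"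
  have mean: "2 * \<alpha> * real (card (uedges ?G)) / real (card (pverts ?G)) = c"
  proof -
    have "2 * \<alpha> * real (card (uedges ?G)) = \<alpha> * ((P * Q - 1) * (P * Q - Q))"
      using card_uedges_unitary_addition_Cayley_graph_prime_power[OF p m]
      unfolding real_power by simp
    moreover have "real (card (pverts ?G)) = P * Q"
      by (simp add: unitary_addition_Cayley_graph_def real_power)
    ultimately show ?thesis using P Q by (simp add: c_def field_simps)
  qed
  have "A_alpha_energy \<alpha> ?G = (\<Sum>k<p * q. cmod (complex_of_real (e k) - complex_of_real c))"
    unfolding A_alpha_energy_def mean A
    by (rule sum_eigenvalues_mset_factorized[of _ "p * q", OF _ factorized])
      (simp add: residue_mat_def)
  also have "\<dots> = (\<Sum>k<p * q. \<bar>e k - c\<bar>)"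
    by (simp flip: of_real_diff)
  also have "\<dots> = \<bar>(x - y) / 2 - c\<bar> + \<bar>(x + y) / 2 - c\<bar> + (\<Sum>k = 2..<p * q. \<bar>diagonal_entry k - c\<bar>)"
  proof -
    have "(\<Sum>k = 2..<p * q. \<bar>e k - c\<bar>) = (\<Sum>k = 2..<p * q. \<bar>diagonal_entry k - c\<bar>)"
      by (rule sum.cong) (auto simp: e_def)
    then show ?thesis unfolding split by (simp add: e_def)
  qed
  also have "(\<Sum>k = 2..<p * q. \<bar>diagonal_entry k - c\<bar>) =
      (P - 3) / 2 * \<bar>\<mu> - 1 - (1 - \<alpha>) * Q - c\<bar> + (P - 1) / 2 * \<bar>\<mu> - 1 + (1 - \<alpha>) * Q - c\<bar>
      + (Q - 1) * (\<bar>\<mu> - c\<bar> + (P - 1) * \<bar>\<mu> - 1 - c\<bar>)"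
    unfolding P_def Q_def by (rule sum_diagonal_entry)
  also have "\<dots> = (P - 3) / 2 * (1 + (1 - \<alpha>) * Q - \<alpha> * (P - 1) / P)
      + (P - 1) / (2 * P) * \<bar>(P * Q - P) * (1 - \<alpha>) - \<alpha>\<bar>
      + (Q - 1) * (\<alpha> * (P - 1) / P + (P - 1) * (1 - \<alpha> * (P - 1) / P))"
  proof -
    \<comment> \<open>The deviation of \<open>\<mu>\<close> from the mean \<open>c\<close> lies between \<open>0\<close> and \<open>1\<close>, which settles the sign of
    all deviations in this sum except that of \<open>\<mu> - 1 + (1 - \<alpha>) * Q\<close>.\<close>
    define s where "s = \<alpha> * (P - 1) / P"
    have "\<alpha> * (P - 1) \<le> 1 * P" using assms(4,5) P by (intro mult_mono) auto
    moreover have "0 \<le> \<alpha> * (P - 1)" using assms(4) P by simp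
    ultimately have s: "0 \<le> s" "s \<le> 1"
      using P by (simp_all add: s_def divide_le_eq)
    have \<mu>: "\<mu> - c = s" using P by (simp add: \<mu>_def c_def s_def field_simps)
    have "0 \<le> (1 - \<alpha>) * Q" using assms(5) Q by simp
    then have "\<bar>\<mu> - 1 - (1 - \<alpha>) * Q - c\<bar> = 1 + (1 - \<alpha>) * Q - s"
      using s \<mu> by linarith
    moreover have "\<bar>\<mu> - c\<bar> = s" "\<bar>\<mu> - 1 - c\<bar> = 1 - s"
      using s \<mu> by linarith+
    moreover have "\<bar>\<mu> - 1 + (1 - \<alpha>) * Q - c\<bar> = \<bar>(P * Q - P) * (1 - \<alpha>) - \<alpha>\<bar> / P"
    proof -
      have "\<mu> - 1 + (1 - \<alpha>) * Q - c = s - 1 + (1 - \<alpha>) * Q" using \<mu> by linarith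
      also have "\<dots> = ((P * Q - P) * (1 - \<alpha>) - \<alpha>) / P"
        using P by (simp add: s_def field_simps)
      finally show ?thesis using P by (simp add: abs_divide)
    qed
    ultimately show ?thesis by (simp add: s_def)
  qed
  also have "(P - 3) / 2 * (1 + (1 - \<alpha>) * Q - \<alpha> * (P - 1) / P)
      + (P - 1) / (2 * P) * \<bar>(P * Q - P) * (1 - \<alpha>) - \<alpha>\<bar>
      + (Q - 1) * (\<alpha> * (P - 1) / P + (P - 1) * (1 - \<alpha> * (P - 1) / P))
    = (3 * (P * Q) - 5 * Q - P - 1) / 2
      + \<alpha> / (2 * P) * (- 3 * (P * P * Q) + 9 * (P * Q) - 4 * Q + P\<^sup>2 - 2 * P + 1)
      + (P - 1) / (2 * P) * \<bar>(P * Q - P) * (1 - \<alpha>) - \<alpha>\<bar>"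
    using P by (simp add: field_simps power2_eq_square)
  finally show ?thesis
    unfolding real_power unfolding P_def[symmetric] c_def
    by (simp only: add.commute add.left_commute add.assoc)
qed

end
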